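(* Let $X$ be a Banach space, $(A_n)_{n\in\mathbb{N}}\subset B(X)$, $D\geqslant 1$, $\varepsilon\geqslant 0$ and $a,b\in\mathbb{R}$. Suppose that the equation $x_{m+1}=A_mx_m$, $m\in\mathbb{N}$, admits a general dichotomy with bounds $$a_{m,n}=D(m-n+1)^a n^{\varepsilon}\ \ ((m,n)\in\mathbb{N}^2_{\geqslant})\qquad\text{and}\qquad b_{m,n}=D(n-m+1)^b n^{\varepsilon}\ \ ((m,n)\in\mathbb{N}^2_{\leqslant}).$$ Let $B_n:X\to X$, $n\in\mathbb{N}$, be bounded linear operators such that $\|B_n\|\leqslant\delta(n+1)^{-\gamma}$ for all $n\in\mathbb{N}$, for some $\delta>0$ and some $\gamma\in\mathbb{R}$. If $$a\leqslant b\leqslant 0,\qquad \varepsilon-\gamma<-1\qquad\text{and}\qquad \theta:=2^{-a}D\delta\left(\zeta_{\gamma-\varepsilon}-1\right)<1,$$ where $\zeta_{\gamma-\varepsilon}=\sum_{k=1}^{+\infty}k^{\varepsilon-\gamma}$, then the equation $x_{m+1}=(A_m+B_m)x_m$, $m\in\mathbb{N}$, admits a general dichotomy with bounds $\frac{D}{1-\theta}(m-n+1)^a n^{\varepsilon}$ (for $(m,n)\in\mathbb{N}^2_{\geqslant}$) and $\frac{D}{1-\theta}(n-m+1)^b n^{\varepsilon}$ (for $(m,n)\in\mathbb{N}^2_{\leqslant}$).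
   Context: $\mathbb{N}=\{1,2,3,\dots\}$; $B(X)$ is the space of bounded linear operators on the Banach space $X$. $\mathbb{N}^2_{\geqslant}=\{(m,n)\in\mathbb{N}^2: m\geqslant n\}$ and $\mathbb{N}^2_{\leqslant}=\{(m,n)\in\mathbb{N}^2: m\leqslant n\}$. For $(A_n)_{n\in\mathbb{N}}\subset B(X)$ and $m\geqslant n$, put $\mathcal{A}_{m,n}=A_{m-1}\cdots A_n$ if $m>n$ and $\mathcal{A}_{n,n}=\mathrm{Id}$. The equation $x_{m+1}=A_mx_m$, $m\in\mathbb{N}$, admits an invariant splitting if there are bounded projections $P_n\in B(X)$, $n\in\mathbb{N}$, such that for every $(m,n)\in\mathbb{N}^2_{\geqslant}$: (S1) $P_m\mathcal{A}_{m,n}=\mathcal{A}_{m,n}P_n$; (S2) $\mathcal{A}_{m,n}(\ker P_n)=\ker P_m$; (S3) $\mathcal{A}_{m,n}|_{\ker P_n}:\ker P_n\to\ker P_m$ is invertible (with bounded inverse). In that case, for $m\geqslant n$, $\mathcal{A}_{n,m}:\ker P_m\to\ker P_n$ denotes the inverse of $\mathcal{A}_{m,n}|_{\ker P_n}$, and $Q_n=\mathrm{Id}-P_n$. The equation admits a general dichotomy with bounds $(a_{m,n})_{(m,n)\in\mathbb{N}^2_{\geqslant}}$ and $(b_{m,n})_{(m,n)\in\mathbb{N}^2_{\leqslant}}$ if it admits an invariant splitting such that (D1) $\|\mathcal{A}_{m,n}P_n\|\leqslant a_{m,n}$ for all $(m,n)\in\mathbb{N}^2_{\geqslant}$ and (D2)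 $\|\mathcal{A}_{m,n}Q_n\|\leqslant b_{m,n}$ for all $(m,n)\in\mathbb{N}^2_{\leqslant}$. *)

theory Defs
  imports "HOL-Analysis.Analysis"
begin

text \<open>
  Sequences are indexed by the positive integers: all conditions below carry the guard
  \<open>1 \<le> n\<close>, so the value of a sequence at \<open>0\<close> is never constrained.
\<close>

text \<open>
  \<open>evol A m n\<close> is the product \<open>A (m - 1) \<cdots> A n\<close> for \<open>m > n\<close> and the identity for \<open>m = n\<close>;
  it is only meaningful for \<open>n \<le> m\<close>.
\<close>
fun evol :: "(nat \<Rightarrow> 'a \<Rightarrow>\<^sub>L 'a) \<Rightarrow> nat \<Rightarrow> nat \<Rightarrow> 'a::real_normed_vector \<Rightarrow>\<^sub>L 'a" where
  "evol A 0 n = id_blinfun"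
| "evol A (Suc m) n = (if n \<le> m then A m o\<^sub>L evol A m n else id_blinfun)"

definition ker :: "('a::real_normed_vector \<Rightarrow>\<^sub>L 'a) \<Rightarrow> 'a set" where
  "ker T = {x. blinfun_apply T x = 0}"

text \<open>
  For \<open>m \<le> n\<close>, the inverse of the restriction of \<open>evol A n m\<close> to a map from \<open>ker (P m)\<close> onto
  \<open>ker (P n)\<close>; it is only meaningful on \<open>ker (P n)\<close>.
\<close>
definition back_evol ::
  "(nat \<Rightarrow> 'a \<Rightarrow>\<^sub>L 'a) \<Rightarrow> (nat \<Rightarrow> 'a \<Rightarrow>\<^sub>L 'a) \<Rightarrow> nat \<Rightarrow> nat \<Rightarrow> 'a::real_normed_vector \<Rightarrow> 'a" where
  "back_evol A P m n = inv_into (ker (P m)) (blinfun_apply (evol A n m))"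

definition invariant_splitting ::
  "(nat \<Rightarrow> 'a::real_normed_vector \<Rightarrow>\<^sub>L 'a) \<Rightarrow> (nat \<Rightarrow> 'a \<Rightarrow>\<^sub>L 'a) \<Rightarrow> bool" where
  "invariant_splitting A P \<longleftrightarrow>
     (\<forall>n\<ge>1. P n o\<^sub>L P n = P n) \<and>
     (\<forall>n\<ge>1. \<forall>m\<ge>n. P m o\<^sub>L evol A m n = evol A m n o\<^sub>L P n) \<and>
     (\<forall>n\<ge>1. \<forall>m\<ge>n. blinfun_apply (evol A m n) ` ker (P n) = ker (P m)) \<and>
     (\<forall>n\<ge>1. \<forall>m\<ge>n. bij_betw (blinfun_apply (evol A m n)) (ker (P n)) (ker (P m)) \<and>
        (\<exists>K. \<forall>y\<in>ker (P m). norm (back_evol A P n m y) \<le> K * norm y))"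

definition compl_proj :: "(nat \<Rightarrow> 'a::real_normed_vector \<Rightarrow>\<^sub>L 'a) \<Rightarrow> nat \<Rightarrow> 'a \<Rightarrow>\<^sub>L 'a" where
  "compl_proj P n = id_blinfun - P n"

text \<open>
  The map measured by \<open>onorm\<close> in the second bound below is a bounded operator on the whole space,
  so that \<open>onorm\<close> really is its operator norm.
\<close>
lemma bounded_linear_back_evol_compl_proj:
  assumes "invariant_splitting A P" and "1 \<le> m" and "m \<le> n"
  shows "bounded_linear (\<lambda>x. back_evol A P m n (blinfun_apply (compl_proj P n) x))"
proof -
  let ?E = "blinfun_apply (evol A n m)" and ?R = "back_evol A P m n"
  have bij: "bij_betw ?E (ker (P m)) (ker (P n))"
    using assms by (auto simp: invariant_splitting_def)
  obtain K where K: "\<And>y. y \<in> ker (P n) \<Longrightarrow> norm (?R y) \<le> K * norm y"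
    using assms unfolding invariant_splitting_def by (meson order.trans)
  have idem: "P n o\<^sub>L P n = P n"
    using assms by (auto simp: invariant_splitting_def)
  have Q: "blinfun_apply (compl_proj P n) x \<in> ker (P n)" for x
    using arg_cong[OF idem, of "\<lambda>T. blinfun_apply T x"]
    by (simp add: ker_def compl_proj_def blinfun.bilinear_simps)
  have R: "?R y \<in> ker (P m)" "?E (?R y) = y" if "y \<in> ker (P n)" for y
    using that bij unfolding back_evol_def
    by (auto simp: bij_betw_def inv_into_into f_inv_into_f)
  have uniq: "?R (?E z) = z" if "z \<in> ker (P m)" for z
    using that bij unfolding back_evol_def by (auto simp: bij_betw_def)
  have add: "?R (y + z) = ?R y + ?R z" if "y \<in> ker (P n)" "z \<in> ker (P n)" for y z
  proof -
    have "?R y + ?R z \<in> ker (P m)"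
      using R(1)[OF that(1)] R(1)[OF that(2)] by (simp add: ker_def blinfun.bilinear_simps)
    from uniq[OF this] show ?thesis
      using R(2)[OF that(1)] R(2)[OF that(2)] by (simp add: blinfun.bilinear_simps)
  qed
  have scale: "?R (c *\<^sub>R y) = c *\<^sub>R ?R y" if "y \<in> ker (P n)" for c y
  proof -
    have "c *\<^sub>R ?R y \<in> ker (P m)"
      using R(1)[OF that] by (simp add: ker_def blinfun.bilinear_simps)
    from uniq[OF this] show ?thesis
      using R(2)[OF that] by (simp add: blinfun.bilinear_simps)
  qed
  show ?thesis
  proof (rule bounded_linear_intro[where K = "\<bar>K\<bar> * norm (compl_proj P n)"])
    fix x
    let ?q = "blinfun_apply (compl_proj P n) x"
    have "norm (?R ?q) \<le> K * norm ?q" by (rule K[OF Q])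
    also have "\<dots> \<le> \<bar>K\<bar> * norm ?q" by (intro mult_right_mono) auto
    also have "\<dots> \<le> \<bar>K\<bar> * (norm (compl_proj P n) * norm x)"
      by (intro mult_left_mono norm_blinfun) auto
    finally show "norm (?R ?q) \<le> norm x * (\<bar>K\<bar> * norm (compl_proj P n))"
      by (simp add: ac_simps)
  qed (simp_all add: blinfun.add_right blinfun.scaleR_right add scale Q)
qed

definition general_dichotomy ::
  "(nat \<Rightarrow> 'a::real_normed_vector \<Rightarrow>\<^sub>L 'a) \<Rightarrow> (nat \<Rightarrow> nat \<Rightarrow> real) \<Rightarrow> (nat \<Rightarrow> nat \<Rightarrow> real) \<Rightarrow> bool"
  where
  "general_dichotomy A a b \<longleftrightarrow>
     (\<exists>P. invariant_splitting A P \<and>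
        (\<forall>n\<ge>1. \<forall>m\<ge>n. norm (evol A m n o\<^sub>L P n) \<le> a m n) \<and>
        (\<forall>m\<ge>1. \<forall>n\<ge>m. onorm (\<lambda>x. back_evol A P m n (blinfun_apply (compl_proj P n) x)) \<le> b m n))"

end

(* An invariant splitting is encoded by its Green function G, where G m n is the evolution of
   the projection P n for m >= n and minus the backward evolution of Q n for m < n. The two
   recursions in m and in n, together with G m n P n = G m n or 0, characterise such G. The Green
   function H of the perturbed equation solves the linear system
     H m n = G m n + (SUM k >= 1. G m (k + 1) B k H k n),
   a contraction on bounded sequences. Its unique solvability transfers the recursion in n and the
   projection identity from G to H; the recursion in m is immediate. The weights c m n given by
   the dichotomy bounds satisfy c m (k + 1) |B k| c k n <= kappa k * c m n, so H inherits the
   bounds up to the factor 1 / (1 - SUM k. kappa k). For polynomial weights this inequality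
   reduces to p q >= (p + q) / 2 for p, q >= 1 and p q >= p + q - 2 for p, q >= 2. *)

theory Submission
  imports Defs
begin

section \<open>Composition rules for evolution operators\<close>

lemma evol_refl [simp]: "evol A n n = id_blinfun"
  by (cases n) auto

lemma evol_Suc: "n \<le> m \<Longrightarrow> evol A (Suc m) n = A m o\<^sub>L evol A m n"
  by simp

declare evol.simps(2) [simp del]

lemma evol_compose:
  assumes "k \<le> n" "n \<le> m"
  shows "blinfun_apply (evol A m n) (blinfun_apply (evol A n k) x) = blinfun_apply (evol A m k) x"
  using assms(2,1) by (induction rule: dec_induct) (auto simp: evol_Suc)

lemma evol_Suc_right:
  "n < m \<Longrightarrow> blinfun_apply (evol A m (Suc n)) (blinfun_apply (A n) x) = blinfun_apply (evol A m n) x"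
  using evol_compose[of n "Suc n" m A x] by (simp add: evol_Suc)

section \<open>Green functions and the invariant splittings they encode\<close>

locale green_function =
  fixes A :: "nat \<Rightarrow> 'a::banach \<Rightarrow>\<^sub>L 'a" and G :: "nat \<Rightarrow> nat \<Rightarrow> 'a \<Rightarrow>\<^sub>L 'a"
  assumes step: "\<And>m n. 1 \<le> m \<Longrightarrow> 1 \<le> n \<Longrightarrow>
      G (Suc m) n = (A m o\<^sub>L G m n) + (if Suc m = n then id_blinfun else 0)"
    and shift: "\<And>m n. 1 \<le> m \<Longrightarrow> 1 \<le> n \<Longrightarrow>
      G m (Suc n) o\<^sub>L A n = G m n - (if m = n then id_blinfun else 0)"
    and proj: "\<And>m n. 1 \<le> m \<Longrightarrow> 1 \<le> n \<Longrightarrow> G m n o\<^sub>L G n n = (if n \<le> m then G m n else 0)"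
begin

lemma step_apply:
  assumes "1 \<le> m" "1 \<le> n"
  shows "G (Suc m) n x = A m (G m n x) + (if Suc m = n then x else 0)"
  by (simp add: step[OF assms] blinfun.bilinear_simps)

lemma shift_apply:
  assumes "1 \<le> m" "1 \<le> n"
  shows "G m (Suc n) (A n x) = G m n x - (if m = n then x else 0)"
  using arg_cong[OF shift[OF assms], of "\<lambda>T. blinfun_apply T x"]
  by (simp add: blinfun.bilinear_simps split: if_splits)

lemma proj_apply:
  assumes "1 \<le> m" "1 \<le> n"
  shows "G m n (G n n x) = (if n \<le> m then G m n x else 0)"
  using arg_cong[OF proj[OF assms], of "\<lambda>T. blinfun_apply T x"]
  by (simp add: blinfun.bilinear_simps split: if_splits)

text \<open>Iterates \<open>step\<close> from \<open>m\<close> up to \<open>j\<close>. The identity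
  term is met at most once, when the first index reaches \<open>n\<close>, and evolves forward from
  there.\<close>

lemma evol_G:
  assumes "m \<le> j" "1 \<le> m" "1 \<le> n"
  shows "G j n x = evol A j m (G m n x) + (if m < n \<and> n \<le> j then evol A j n x else 0)"
  using assms(1)
proof (induction rule: dec_induct)
  case (step j)
  then show ?case
    using assms step_apply[of j n x]
    by (auto simp: evol_Suc blinfun.bilinear_simps not_le less_Suc_eq_le le_Suc_eq)
qed auto

text \<open>Iterates \<open>shift\<close> from \<open>k\<close> up to \<open>n\<close>, the
  counterpart of \<open>evol_G\<close> in the second index. The identity is subtracted when the
  moving index equals \<open>m\<close>.\<close>

lemma G_evol:
  assumes "k \<le> n" "1 \<le> m" "1 \<le> k"
  shows "G m n (evol A n k x) = G m k x - (if k \<le> m \<and> m < n then evol A m k x else 0)"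
  using assms(1)
proof (induction rule: dec_induct)
  case (step n)
  then show ?case
    using assms shift_apply[of m n "evol A n k x"]
    by (auto simp: evol_Suc blinfun.bilinear_simps)
qed auto

lemma evol_P:
  assumes "1 \<le> n" "n \<le> m"
  shows "evol A m n (G n n x) = G m n x"
  using evol_G[of n m n x] assms by auto

lemma P_evol:
  assumes "1 \<le> n" "n \<le> m"
  shows "G m m (evol A m n x) = G m n x"
  using G_evol[of n m m x] assms by auto

text \<open>Makes \<open>- G m n\<close> a left inverse of the evolution on the kernel at
  \<open>m\<close>; \<open>evol_G_ker\<close> supplies the right inverse, though without placing its
  values in that kernel.\<close>

lemma G_evol_ker:
  assumes "1 \<le> m" "m < n" "G m m x = 0"
  shows "G m n (evol A n m x) = - x"
  using G_evol[of m n m x] assms by auto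

lemma evol_G_ker:
  assumes "1 \<le> m" "m < n" "G n n y = 0"
  shows "evol A n m (G m n y) = - y"
  using evol_G[of m n n y] assms by (auto simp: eq_neg_iff_add_eq_0)

lemma evol_ker: "1 \<le> m \<Longrightarrow> m \<le> n \<Longrightarrow> G m m x = 0 \<Longrightarrow> G n n (evol A n m x) = 0"
  by (metis evol_P P_evol blinfun.zero_right)

lemma ker_evolE:
  assumes "1 \<le> m" "m \<le> n" "G n n y = 0"
  obtains x where "G m m x = 0" "evol A n m x = y"
proof (cases "m = n")
  case True
  then show ?thesis using assms that[of y] by auto
next
  case False
  \<comment> \<open>The preimage \<open>- G m n y\<close> is corrected by its \<open>G m m\<close>
    component so that it lies in the kernel. The correction evolves to
    \<open>G n n (evol A n m (G m n y))\<close>, which is \<open>- G n n y = 0\<close>, so the image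
    is unchanged.\<close>
  let ?x = "G m m (G m n y) - G m n y"
  have "G m m ?x = 0"
    using proj_apply[of m m] assms by (auto simp: blinfun.bilinear_simps)
  moreover have "evol A n m ?x = y"
    using assms False evol_G_ker[of m n y] P_evol[of m n "G m n y"] evol_P[of m n "G m n y"]
    by (auto simp: blinfun.bilinear_simps)
  ultimately show ?thesis by (rule that)
qed

lemma G_compl:
  assumes "1 \<le> m" "m < n"
  shows "G m n x = G m n (x - G n n x)"
  using proj_apply[of m n x] assms by (auto simp: blinfun.bilinear_simps)

text \<open>Needed for \<open>pert_proj\<close>. For \<open>k \<le> n\<close> the column is the
  forward evolution of a projected vector, and \<open>G_evol\<close> evaluates the product. For
  \<open>m < n < k\<close> both factors are minus backward evolutions, so the signs cancel and the
  result is \<open>- G m k\<close>.\<close>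

lemma G_comp:
  assumes "1 \<le> m" "1 \<le> n" "1 \<le> k"
  shows "G m n o\<^sub>L G n k =
    (if n \<le> m then if k \<le> n then G m k else 0 else if k \<le> n then 0 else - G m k)"
proof (rule blinfun_eqI)
  fix y
  show "(G m n o\<^sub>L G n k) y =
    (if n \<le> m then if k \<le> n then G m k else 0 else if k \<le> n then 0 else - G m k) y"
  proof (cases "k \<le> n")
    case True
    have "G m n (G n k y) = G m n (evol A n k (G k k y))"
      using evol_P[of k n y] assms True by auto
    also have "\<dots> = G m k (G k k y) - (if k \<le> m \<and> m < n then evol A m k (G k k y) else 0)"
      using G_evol[of k n m "G k k y"] assms True by auto
    also have "\<dots> = (if n \<le> m then G m k y else 0)"
      using proj_apply[of m k y] evol_P[of k m y] assms True by auto
    finally show ?thesis using True by (simp add: blinfun.bilinear_simps)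
  next
    case False
    \<comment> \<open>Pulling the kernel component of \<open>y\<close> back to the earlier of
      \<open>m\<close> and \<open>n\<close> gives a vector \<open>x\<close> with
      \<open>G n k y = - evol A n l x\<close>; if \<open>m < n\<close>, then \<open>l = m\<close>
      and also \<open>G m k y = - x\<close>.\<close>
    define l where "l = min m n"
    have l: "1 \<le> l" "l \<le> m" "l \<le> n" "l < k" using assms False by (auto simp: l_def)
    have "G k k (y - G k k y) = 0"
      using proj_apply[of k k y] assms by (simp add: blinfun.bilinear_simps)
    then obtain x where x: "G l l x = 0" "evol A k l x = y - G k k y"
      using ker_evolE[of l k "y - G k k y"] l by auto
    have u: "G n n (evol A n l x) = 0" using evol_ker[of l n x] l x by auto
    have "G n k y = G n k (evol A k n (evol A n l x))"
      using G_compl[of n k y] x assms False l evol_compose[of l n k A x] by auto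
    also have "\<dots> = - evol A n l x"
      using G_evol_ker[of n k "evol A n l x"] u assms False by auto
    finally have Gn: "G n k y = - evol A n l x" .
    show ?thesis
    proof (cases "n \<le> m")
      case True
      then have "G m n (evol A n l x) = 0"
        using evol_P[of n m "evol A n l x"] u assms by (auto simp: blinfun.bilinear_simps)
      then show ?thesis using True False Gn by (simp add: blinfun.bilinear_simps)
    next
      case nm: False
      then have [simp]: "l = m" by (simp add: l_def)
      have "G m k y = - x"
        using G_compl[of m k y] x assms l G_evol_ker[of m k x] by auto
      moreover have "G m n (evol A n l x) = - x"
        using G_evol_ker[of m n x] x nm assms by auto
      ultimately show ?thesis using nm False Gn by (simp add: blinfun.bilinear_simps)
    qed
  qed
qed

lemma bij_betw_evol_ker:
  assumes "1 \<le> m" "m \<le> n"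
  shows "bij_betw (blinfun_apply (evol A n m)) (ker (G m m)) (ker (G n n))"
proof (rule bij_betw_imageI)
  show "inj_on (blinfun_apply (evol A n m)) (ker (G m m))"
  proof (cases "m = n")
    case False
    then show ?thesis
      using G_evol_ker assms by (intro inj_on_inverseI[where g = "\<lambda>y. - G m n y"]) (auto simp: ker_def)
  qed auto
  show "blinfun_apply (evol A n m) ` ker (G m m) = ker (G n n)"
    using evol_ker[OF assms] ker_evolE[OF assms] by (fastforce simp: ker_def)
qed

text \<open>On the kernel of \<open>G n n\<close> the backward evolution at \<open>m = n\<close> is
  the identity while \<open>G n n\<close> is zero, so the diagonal is separated from the strictly
  backward case.\<close>

lemma back_evol_eq:
  assumes "1 \<le> m" "m \<le> n" "G n n y = 0"
  shows "back_evol A (\<lambda>n. G n n) m n y = (if m = n then y else - G m n y)"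
proof -
  obtain x where x: "G m m x = 0" "evol A n m x = y" using ker_evolE assms by blast
  have "back_evol A (\<lambda>n. G n n) m n y = x"
    unfolding back_evol_def using bij_betw_evol_ker[OF assms(1,2)] x
    by (intro inv_into_f_eq) (auto simp: bij_betw_def ker_def)
  then show ?thesis using x G_evol_ker[of m n x] assms by auto
qed

lemma invariant_splitting_diagonal: "invariant_splitting A (\<lambda>n. G n n)"
  unfolding invariant_splitting_def
proof (intro conjI allI impI)
  fix n :: nat assume n: "1 \<le> n"
  show "G n n o\<^sub>L G n n = G n n" using proj[of n n] n by simp
  fix m assume mn: "n \<le> m"
  show "G m m o\<^sub>L evol A m n = evol A m n o\<^sub>L G n n"
    using P_evol evol_P n mn by (auto intro!: blinfun_eqI)
  show bij: "bij_betw (blinfun_apply (evol A m n)) (ker (G n n)) (ker (G m m))"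
    using bij_betw_evol_ker n mn by auto
  then show "blinfun_apply (evol A m n) ` ker (G n n) = ker (G m m)"
    by (auto simp: bij_betw_def)
  \<comment> \<open>The maximum with 1 covers \<open>m = n\<close>, where the inverse is the
    identity on the kernel.\<close>
  have "norm (back_evol A (\<lambda>n. G n n) n m y) \<le> max 1 (norm (G n m)) * norm y"
    if "y \<in> ker (G m m)" for y
  proof -
    have "1 * norm y \<le> max 1 (norm (G n m)) * norm y"
      by (intro mult_right_mono) auto
    moreover have "norm (G n m y) \<le> max 1 (norm (G n m)) * norm y"
      by (rule order_trans[OF norm_blinfun]) (intro mult_right_mono, auto)
    ultimately show ?thesis
      using back_evol_eq[of n m y] that n mn by (auto simp: ker_def)
  qed
  then show "\<exists>K. \<forall>y\<in>ker (G m m). norm (back_evol A (\<lambda>n. G n n) n m y) \<le> K * norm y"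
    by blast
qed

text \<open>For \<open>m < n\<close> the operator \<open>G m n\<close> vanishes on the range of
  \<open>G n n\<close>, so passing to the complementary component changes nothing. On the diagonal
  the complementary projection appears, which is not an entry of \<open>G\<close>; hence the
  separate bound in \<open>general_dichotomy_iff_green_function\<close>.\<close>

lemma onorm_back_evol:
  assumes "1 \<le> m" "m \<le> n"
  shows "onorm (\<lambda>x. back_evol A (\<lambda>n. G n n) m n (compl_proj (\<lambda>n. G n n) n x)) =
    (if m = n then norm (id_blinfun - G n n) else norm (G m n))"
proof -
  have "back_evol A (\<lambda>n. G n n) m n (compl_proj (\<lambda>n. G n n) n x) =
      (if m = n then id_blinfun - G n n else - G m n) x" for x
  proof -
    have "G n n (x - G n n x) = 0"
      using proj_apply[of n n x] assms by (simp add: blinfun.bilinear_simps)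
    then show ?thesis
      using back_evol_eq[of m n "x - G n n x"] G_compl[of m n x] assms
      by (auto simp: compl_proj_def blinfun.bilinear_simps)
  qed
  then show ?thesis
    by (auto simp flip: norm_blinfun.rep_eq)
qed

end

text \<open>Replaces inverses on varying kernels by bounded operators on the whole space tied by
  linear recursions, a form in which a perturbation can be solved for.\<close>

lemma general_dichotomy_iff_green_function:
  fixes A :: "nat \<Rightarrow> 'a::banach \<Rightarrow>\<^sub>L 'a"
  shows "general_dichotomy A a b \<longleftrightarrow>
    (\<exists>G. green_function A G \<and>
      (\<forall>m\<ge>1. \<forall>n\<ge>1. norm (G m n) \<le> (if n \<le> m then a m n else b m n)) \<and>
      (\<forall>n\<ge>1. norm (id_blinfun - G n n) \<le> b n n))"
    (is "?L \<longleftrightarrow> ?R")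
proof
  assume ?R
  then obtain G where "green_function A G"
    and bd: "\<And>m n. 1 \<le> m \<Longrightarrow> 1 \<le> n \<Longrightarrow> norm (G m n) \<le> (if n \<le> m then a m n else b m n)"
    and bd1: "\<And>n. 1 \<le> n \<Longrightarrow> norm (id_blinfun - G n n) \<le> b n n"
    by blast
  then interpret green_function A G by simp
  show ?L
    unfolding general_dichotomy_def
  proof (intro exI[of _ "\<lambda>n. G n n"] conjI allI impI invariant_splitting_diagonal)
    fix m n :: nat assume "1 \<le> n" "n \<le> m"
    moreover from this have "evol A m n o\<^sub>L G n n = G m n"
      using evol_P by (auto intro!: blinfun_eqI)
    ultimately show "norm (evol A m n o\<^sub>L G n n) \<le> a m n" using bd[of m n] by auto
  next
    fix m n :: nat assume "1 \<le> m" "m \<le> n"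
    then show "onorm (\<lambda>x. back_evol A (\<lambda>n. G n n) m n (compl_proj (\<lambda>n. G n n) n x)) \<le> b m n"
      using bd[of m n] bd1[of n] by (auto simp: onorm_back_evol)
  qed
next
  assume ?L
  then obtain P where spl: "invariant_splitting A P"
    and a: "\<And>m n. 1 \<le> n \<Longrightarrow> n \<le> m \<Longrightarrow> norm (evol A m n o\<^sub>L P n) \<le> a m n"
    and b: "\<And>m n. 1 \<le> m \<Longrightarrow> m \<le> n \<Longrightarrow>
        onorm (\<lambda>x. back_evol A P m n (compl_proj P n x)) \<le> b m n"
    unfolding general_dichotomy_def by blast
  define R where "R m n = Blinfun (\<lambda>x. back_evol A P m n (compl_proj P n x))" for m n
  define G where "G m n = (if n \<le> m then evol A m n o\<^sub>L P n else - R m n)" for m n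
  have R_apply: "R m n x = back_evol A P m n (x - P n x)" if "1 \<le> m" "m \<le> n" for m n x
    using bounded_linear_back_evol_compl_proj[OF spl that]
    by (simp add: R_def bounded_linear_Blinfun_apply compl_proj_def blinfun.bilinear_simps)
  have PP: "P n (P n x) = P n x" if "1 \<le> n" for n x
    using spl that unfolding invariant_splitting_def by (metis blinfun_apply_blinfun_compose)
  have PE: "P m (evol A m n x) = evol A m n (P n x)" if "1 \<le> n" "n \<le> m" for m n x
    using spl that unfolding invariant_splitting_def by (metis blinfun_apply_blinfun_compose)
  have PA: "P (Suc n) (A n x) = A n (P n x)" if "1 \<le> n" for n x
    using PE[of n "Suc n" x] that by (simp add: evol_Suc)
  have bij: "bij_betw (blinfun_apply (evol A n m)) (ker (P m)) (ker (P n))"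
    if "1 \<le> m" "m \<le> n" for m n
    using spl that unfolding invariant_splitting_def by blast
  have back1: "P m (back_evol A P m n y) = 0" "evol A n m (back_evol A P m n y) = y"
    if "1 \<le> m" "m \<le> n" "P n y = 0" for m n y
    using bij_betwE[OF bij_betw_inv_into[OF bij[OF that(1,2)]]]
      bij_betw_inv_into_right[OF bij[OF that(1,2)], of y] that
    unfolding back_evol_def ker_def by auto
  have back2: "back_evol A P m n y = x" if "1 \<le> m" "m \<le> n" "P m x = 0" "evol A n m x = y" for m n x y
    using bij_betw_inv_into_left[OF bij[OF that(1,2)], of x] that
    unfolding back_evol_def ker_def by auto
  have Q: "P n (x - P n x) = 0" if "1 \<le> n" for n x
    using PP[OF that] by (simp add: blinfun.bilinear_simps)
  have "green_function A G"
  proof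
    fix m n :: nat assume mn: "1 \<le> m" "1 \<le> n"
    show "G (Suc m) n = (A m o\<^sub>L G m n) + (if Suc m = n then id_blinfun else 0)"
    proof (rule blinfun_eqI)
      fix x
      consider "n \<le> m" | "n = Suc m" | "Suc m < n" by linarith
      then show "G (Suc m) n x = ((A m o\<^sub>L G m n) + (if Suc m = n then id_blinfun else 0)) x"
      proof cases
        case 1
        then show ?thesis by (simp add: G_def evol_Suc)
      next
        \<comment> \<open>Here \<open>A m\<close> carries the backward evolution to
          \<open>x - P n x\<close>, so the first summand is \<open>P n x - x\<close> and the
          identity term restores \<open>P n x\<close>.\<close>
        case 2
        then show ?thesis
          using mn back1(2)[of m n "x - P n x"] Q[of n x]
          by (simp add: G_def evol_Suc R_apply blinfun.bilinear_simps)
      next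
        case 3
        let ?u = "back_evol A P m n (x - P n x)"
        have "P (Suc m) (A m ?u) = 0" 
          using back1(1)[of m n "x - P n x"] Q[of n x] mn 3 by (simp add: PA)
        moreover have "evol A n (Suc m) (A m ?u) = x - P n x"
          using back1(2)[of m n "x - P n x"] Q[of n x] mn 3 by (simp add: evol_Suc_right)
        ultimately have "back_evol A P (Suc m) n (x - P n x) = A m ?u"
          using back2[of "Suc m" n "A m ?u"] 3 by simp
        then show ?thesis
          using mn 3 by (simp add: G_def R_apply blinfun.bilinear_simps)
      qed
    qed
    show "G m (Suc n) o\<^sub>L A n = G m n - (if m = n then id_blinfun else 0)"
    proof (rule blinfun_eqI)
      fix x
      show "(G m (Suc n) o\<^sub>L A n) x = (G m n - (if m = n then id_blinfun else 0)) x"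
      proof (cases "n < m")
        case True
        then show ?thesis using mn by (simp add: G_def PA evol_Suc_right)
      next
        case False
        let ?u = "back_evol A P m n (x - P n x)"
        have u: "P m ?u = 0" "evol A n m ?u = x - P n x"
          using back1[of m n "x - P n x"] Q[of n x] mn False by auto
        \<comment> \<open>Since \<open>A n\<close> sends \<open>x - P n x\<close> to the
          complementary component of \<open>A n x\<close> at \<open>n + 1\<close>, the same
          \<open>?u\<close> is its backward evolution. For \<open>m = n\<close> it equals
          \<open>x - P n x\<close>, which accounts for the subtracted identity.\<close>
        then have "back_evol A P m (Suc n) (A n x - P (Suc n) (A n x)) = ?u"
          using mn False by (intro back2) (auto simp: evol_Suc PA blinfun.bilinear_simps)
        then show ?thesis
          using mn False u by (auto simp: G_def R_apply blinfun.bilinear_simps)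
      qed
    qed
    show "G m n o\<^sub>L G n n = (if n \<le> m then G m n else 0)"
      \<comment> \<open>For \<open>m < n\<close> the backward evolution is applied to
        \<open>P n x - P n (P n x) = 0\<close>.\<close>
      using mn back2[of m n 0 0]
      by (auto intro!: blinfun_eqI simp: G_def PP R_apply blinfun.bilinear_simps)
  qed
  moreover have "norm (R m n) \<le> b m n" if "1 \<le> m" "m \<le> n" for m n
    using b[OF that] bounded_linear_back_evol_compl_proj[OF spl that]
    by (simp add: R_def norm_blinfun.rep_eq bounded_linear_Blinfun_apply)
  then have "norm (G m n) \<le> (if n \<le> m then a m n else b m n)" if "1 \<le> m" "1 \<le> n" for m n
    using a[of n m] that by (auto simp: G_def)
  moreover have "norm (id_blinfun - G n n) \<le> b n n" if "1 \<le> n" for n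
  proof -
    have "back_evol A P n n (compl_proj P n x) = (id_blinfun - G n n) x" for x
      using that Q[of n x] by (intro back2) (auto simp: G_def compl_proj_def blinfun.bilinear_simps)
    then show ?thesis using b[of n n] that by (simp add: norm_blinfun.rep_eq)
  qed
  ultimately show ?R by blast
qed


section \<open>Linear summation equations with a contractive kernel\<close>

lemma blinfun_compose_assoc: "(S o\<^sub>L T) o\<^sub>L U = S o\<^sub>L (T o\<^sub>L U)"
  by (rule blinfun_eqI) simp

lemma blinfun_compose_id_left: "id_blinfun o\<^sub>L T = T"
  by (rule blinfun_eqI) simp

lemma blinfun_compose_id_right: "T o\<^sub>L id_blinfun = T"
  by (rule blinfun_eqI) simp

locale contractive_kernel =
  fixes K :: "nat \<Rightarrow> nat \<Rightarrow> 'a::banach \<Rightarrow>\<^sub>L 'a" and \<kappa> :: "nat \<Rightarrow> real"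
  assumes norm_K: "norm (K m k) \<le> \<kappa> k"
    and summable_\<kappa>: "summable \<kappa>"
    and suminf_\<kappa>: "suminf \<kappa> < 1"
begin

definition kernel_sum :: "nat \<Rightarrow> (nat \<Rightarrow> 'a \<Rightarrow>\<^sub>L 'a) \<Rightarrow> 'a \<Rightarrow>\<^sub>L 'a" where
  "kernel_sum m z = (\<Sum>k. K m k o\<^sub>L z k)"

lemma \<kappa>_nonneg: "0 \<le> \<kappa> k"
  using norm_ge_zero norm_K order_trans by blast

lemma suminf_\<kappa>_nonneg: "0 \<le> suminf \<kappa>"
  by (rule suminf_nonneg[OF summable_\<kappa> \<kappa>_nonneg])

lemma summable_kernel:
  assumes "\<And>k. norm (z k) \<le> C"
  shows "summable (\<lambda>k. K m k o\<^sub>L z k)"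
proof (rule summable_comparison_test'[OF summable_mult2[OF summable_\<kappa>, of C]])
  fix k
  have "norm (K m k o\<^sub>L z k) \<le> norm (K m k) * norm (z k)" by (rule norm_blinfun_compose)
  also have "\<dots> \<le> \<kappa> k * C" using assms by (intro mult_mono norm_K \<kappa>_nonneg) auto
  finally show "norm (K m k o\<^sub>L z k) \<le> \<kappa> k * C" .
qed

text \<open>Only the product of norms is bounded, so \<open>C\<close> may be a sup bound or the
  weight of row \<open>m\<close>; the contraction and the weighted estimates both come from
  here.\<close>

lemma norm_kernel_sum_le:
  assumes "\<And>k. norm (K m k) * norm (z k) \<le> \<kappa> k * C"
  shows "norm (kernel_sum m z) \<le> suminf \<kappa> * C"
  unfolding kernel_sum_def suminf_mult2[OF summable_\<kappa>]
  by (rule norm_suminf_le[OF order_trans[OF norm_blinfun_compose assms] summable_mult2[OF summable_\<kappa>]])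

lemma kernel_sum_diff:
  assumes "\<And>k. norm (z k) \<le> C" "\<And>k. norm (z' k) \<le> C'"
  shows "kernel_sum m (\<lambda>k. z k - z' k) = kernel_sum m z - kernel_sum m z'"
  unfolding kernel_sum_def
  by (subst suminf_diff[OF summable_kernel[of z, OF assms(1)] summable_kernel[of z', OF assms(2)]])
     (simp add: bounded_bilinear.diff_right[OF bounded_bilinear_blinfun_compose])

lemma kernel_sum_compose:
  assumes "\<And>k. norm (z k) \<le> C"
  shows "kernel_sum m (\<lambda>k. z k o\<^sub>L T) = kernel_sum m z o\<^sub>L T"
  unfolding kernel_sum_def
  by (subst bounded_linear.suminf[OF bounded_bilinear.bounded_linear_left[OF bounded_bilinear_blinfun_compose]
        summable_kernel[of z, OF assms]])
     (simp add: blinfun_compose_assoc)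

lemma norm_diff_kernel_sum_le:
  assumes "\<And>k. norm (z k) \<le> C" "\<And>k. norm (z' k) \<le> C'" "\<And>k. norm (z k - z' k) \<le> d"
  shows "norm (kernel_sum m z - kernel_sum m z') \<le> suminf \<kappa> * d"
  unfolding kernel_sum_diff[OF assms(1,2), symmetric]
  by (rule norm_kernel_sum_le) (intro mult_mono norm_K assms(3) \<kappa>_nonneg norm_ge_zero)

text \<open>The supremum \<open>s\<close> of the distances satisfies
  \<open>s \<le> suminf \<kappa> * s\<close>, hence \<open>s \<le> 0\<close>. Arbitrary bounds
  \<open>C\<close> and \<open>C'\<close> are allowed because the sequences compared later are
  bounded by different constants.\<close>

lemma fixed_point_unique:
  assumes y: "\<And>m. y m = h m + kernel_sum m y" "\<And>m. norm (y m) \<le> C"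
    and z: "\<And>m. z m = h m + kernel_sum m z" "\<And>m. norm (z m) \<le> C'"
  shows "y = z"
proof -
  define s where "s = (SUP m. norm (y m - z m))"
  have "norm (y m - z m) \<le> C + C'" for m
    using norm_triangle_ineq4[of "y m" "z m"] y(2)[of m] z(2)[of m] by linarith
  then have s: "norm (y m - z m) \<le> s" for m
    unfolding s_def by (intro cSUP_upper bdd_aboveI2) auto
  have "norm (y m - z m) \<le> suminf \<kappa> * s" for m
    by (subst y(1), subst z(1)) (use norm_diff_kernel_sum_le[OF y(2) z(2) s] in simp)
  then have "s \<le> suminf \<kappa> * s"
    unfolding s_def by (intro cSUP_least) auto
  then have "(1 - suminf \<kappa>) * s \<le> 0" by (simp add: algebra_simps)
  then have "s \<le> 0" using suminf_\<kappa> by (simp add: mult_le_0_iff)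
  then show ?thesis using s by (metis norm_le_zero_iff order_trans right_minus_eq ext)
qed

text \<open>Banach's fixed point theorem on the sequences obeying a pointwise weighted bound.
  \<open>Kc\<close> keeps this set invariant, while distances are measured in the plain sup
  norm.\<close>

lemma fixed_point_exists:
  assumes h: "\<And>m. norm (h m) \<le> c m"
    and c: "\<And>m. 0 \<le> c m" "\<And>m. c m \<le> C"
    and Kc: "\<And>m k. norm (K m k) * c k \<le> \<kappa> k * c m"
  obtains z where "\<And>m. norm (z m) \<le> c m / (1 - suminf \<kappa>)" "\<And>m. z m = h m + kernel_sum m z"
proof -
  \<comment> \<open>\<open>r m\<close> solves \<open>c m + suminf \<kappa> * r m = r m\<close>, so a
    bound by \<open>r\<close> reproduces itself under the map.\<close>
  define r where "r m = c m / (1 - suminf \<kappa>)" for m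
  \<comment> \<open>Because \<open>nat\<close> is discrete, bounded continuous functions are exactly
    bounded sequences.\<close>
  define S :: "(nat \<Rightarrow>\<^sub>C ('a \<Rightarrow>\<^sub>L 'a)) set" where "S = {z. \<forall>m. norm (apply_bcontfun z m) \<le> r m}"
  have r: "0 \<le> r m" "r m \<le> C / (1 - suminf \<kappa>)" "c m + suminf \<kappa> * r m = r m" for m
    using c[of m] suminf_\<kappa> by (auto simp: r_def divide_right_mono) (simp add: field_simps)
  have S_iff: "z \<in> S \<longleftrightarrow> (\<forall>m. norm (apply_bcontfun z m) \<le> r m)" for z
    by (simp add: S_def)
  have bcont: "z \<in> bcontfun" if "\<And>m. norm (z m) \<le> r m" for z :: "nat \<Rightarrow> 'a \<Rightarrow>\<^sub>L 'a"
    by (rule bcontfun_normI[where b = "C / (1 - suminf \<kappa>)"]) (auto intro: order_trans[OF that r(2)])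
  define F where "F z = Bcontfun (\<lambda>m. h m + kernel_sum m (apply_bcontfun z))" for z
  have le_r: "norm (h m + kernel_sum m (apply_bcontfun z)) \<le> r m" if "z \<in> S" for z m
  proof -
    have "norm (K m k) * norm (apply_bcontfun z k) \<le> \<kappa> k * r m" for k
    proof -
      have "norm (K m k) * norm (apply_bcontfun z k) \<le> norm (K m k) * r k"
        using that by (intro mult_left_mono) (auto simp: S_iff)
      also have "\<dots> \<le> \<kappa> k * r m"
        using divide_right_mono[OF Kc[of m k], of "1 - suminf \<kappa>"] suminf_\<kappa> by (simp add: r_def)
      finally show ?thesis .
    qed
    then have "norm (kernel_sum m (apply_bcontfun z)) \<le> suminf \<kappa> * r m"
      by (rule norm_kernel_sum_le)
    then show ?thesis
      using norm_triangle_ineq[of "h m" "kernel_sum m (apply_bcontfun z)"] h[of m] r(3)[of m] by linarith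
  qed
  have F: "apply_bcontfun (F z) m = h m + kernel_sum m (apply_bcontfun z)" if "z \<in> S" for z m
    unfolding F_def by (subst Bcontfun_inverse[OF bcont[OF le_r[OF that]]]) simp
  have "\<exists>!z\<in>S. F z = z"
  proof (rule Banach_fix)
    show "complete S"
      unfolding complete_def
    proof (intro allI impI, elim conjE)
      fix f assume f: "\<forall>i. f i \<in> S" and "Cauchy f"
      then obtain g where g: "uniform_limit UNIV (\<lambda>i. apply_bcontfun (f i)) g sequentially"
        using uniformly_convergent_eq_cauchy[of "\<lambda>_. True" "\<lambda>i. apply_bcontfun (f i)"]
        unfolding Cauchy_def uniform_limit_sequentially_iff
        by (metis dist_fun_lt_imp_dist_val_lt)
      obtain l where l: "g = apply_bcontfun l" "f \<longlonglongrightarrow> l"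
        using uniform_limit_bcontfunE[OF g sequentially_bot] by metis
      have "norm (apply_bcontfun l m) \<le> r m" for m
      proof (rule LIMSEQ_le_const2)
        show "(\<lambda>i. norm (apply_bcontfun (f i) m)) \<longlonglongrightarrow> norm (apply_bcontfun l m)"
          using tendsto_uniform_limitI[OF g, of m] l by (intro tendsto_norm) simp
        show "\<exists>N. \<forall>i\<ge>N. norm (apply_bcontfun (f i) m) \<le> r m" using f by (simp add: S_iff)
      qed
      then show "\<exists>l\<in>S. f \<longlonglongrightarrow> l" using l(2) S_iff by blast
    qed
    have "0 \<in> S" using r(1) by (simp add: S_iff)
    then show "S \<noteq> {}" by blast
    show "0 \<le> suminf \<kappa>" "suminf \<kappa> < 1" using suminf_\<kappa>_nonneg suminf_\<kappa> by auto
    show "F ` S \<subseteq> S" using le_r by (auto simp: S_iff F)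
    fix y z assume yz: "y \<in> S" "z \<in> S"
    show "dist (F y) (F z) \<le> suminf \<kappa> * dist y z"
    proof (rule dist_bound)
      fix m
      have "norm (kernel_sum m (apply_bcontfun y) - kernel_sum m (apply_bcontfun z)) \<le> suminf \<kappa> * dist y z"
        by (rule norm_diff_kernel_sum_le[OF norm_bounded norm_bounded])
          (use dist_bounded[of y _ z] in \<open>simp add: dist_norm\<close>)
      then show "dist (apply_bcontfun (F y) m) (apply_bcontfun (F z) m) \<le> suminf \<kappa> * dist y z"
        using yz by (simp add: F dist_norm)
    qed
  qed
  then obtain z where "z \<in> S" "F z = z" by blast
  then show ?thesis
    using that[of "apply_bcontfun z"] F[of z] by (simp add: S_iff r_def)
qed

end

section \<open>Perturbation of Green functions under weighted bounds\<close>

locale perturbed_green_function = green_function A G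
  for A :: "nat \<Rightarrow> 'a::banach \<Rightarrow>\<^sub>L 'a" and G and B :: "nat \<Rightarrow> 'a \<Rightarrow>\<^sub>L 'a"
    and c :: "nat \<Rightarrow> nat \<Rightarrow> real" and M \<kappa> :: "nat \<Rightarrow> real" +
  assumes norm_G: "\<And>m n. 1 \<le> m \<Longrightarrow> 1 \<le> n \<Longrightarrow> norm (G m n) \<le> c m n"
    and norm_Q: "\<And>n. 1 \<le> n \<Longrightarrow> norm (id_blinfun - G n n) \<le> c n n"
    and c_nonneg: "\<And>m n. 0 \<le> c m n"
    and c_le: "\<And>m n. 1 \<le> n \<Longrightarrow> c m n \<le> M n"
    and \<kappa>0: "0 \<le> \<kappa> 0"
    and c_B: "\<And>m k. 1 \<le> m \<Longrightarrow> 1 \<le> k \<Longrightarrow> c m (Suc k) * norm (B k) \<le> \<kappa> k"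
    and c_B_c: "\<And>m k n. 1 \<le> m \<Longrightarrow> 1 \<le> k \<Longrightarrow> 1 \<le> n \<Longrightarrow>
      c m (Suc k) * norm (B k) * c k n \<le> \<kappa> k * c m n"
    and sum_\<kappa>: "summable \<kappa>" "suminf \<kappa> < 1"
begin

text \<open>\<open>B k\<close> acts between the times \<open>k\<close> and \<open>k + 1\<close>,
  hence the second index \<open>Suc k\<close>. The zero values at index 0 let sums over
  \<open>nat\<close> stand for sums over the positive integers.\<close>

definition K :: "nat \<Rightarrow> nat \<Rightarrow> 'a \<Rightarrow>\<^sub>L 'a" where
  "K m k = (if m = 0 \<or> k = 0 then 0 else G m (Suc k) o\<^sub>L B k)"

lemma norm_K_le: "1 \<le> m \<Longrightarrow> 1 \<le> k \<Longrightarrow> norm (K m k) \<le> c m (Suc k) * norm (B k)"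
  using norm_blinfun_compose[of "G m (Suc k)" "B k"]
    mult_right_mono[OF norm_G[of m "Suc k"] norm_ge_zero[of "B k"]]
  by (simp add: K_def)

lemma \<kappa>_ge_0: "0 \<le> \<kappa> k"
  using c_B[of 1 k] \<kappa>0 c_nonneg[of 1 "Suc k"] 
  by (cases "k = 0") (auto intro: order_trans[rotated])

text \<open>\<open>c_B\<close> bounds the kernel uniformly in the row, which gives the contraction;
  \<open>c_B_c\<close>, in the form \<open>K_c\<close>, preserves the weighted bound of each
  column.\<close>

sublocale contractive_kernel K \<kappa>
proof
  show "norm (K m k) \<le> \<kappa> k" for m k
    using norm_K_le[of m k] c_B[of m k] \<kappa>_ge_0[of k] by (cases "m = 0 \<or> k = 0") (auto simp: K_def)
qed (fact sum_\<kappa>)+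

lemma K_c: 
  assumes "1 \<le> n"
  shows "norm (K m k) * c k n \<le> \<kappa> k * c m n"
proof (cases "m = 0 \<or> k = 0")
  case True
  then show ?thesis using \<kappa>_ge_0 c_nonneg by (simp add: K_def)
next
  case False
  then show ?thesis
    using mult_right_mono[OF norm_K_le[of m k] c_nonneg[of k n]] c_B_c[of m k n] assms by auto
qed

definition green_solution :: "nat \<Rightarrow> (nat \<Rightarrow> 'a \<Rightarrow>\<^sub>L 'a) \<Rightarrow> bool" where
  "green_solution n z \<longleftrightarrow> (\<forall>m. norm (z m) \<le> c m n / (1 - suminf \<kappa>)) \<and>
    (\<forall>m. z m = (if m = 0 then 0 else G m n) + kernel_sum m z)"

text \<open>Each column \<open>n\<close> is a separate fixed-point problem;
  \<open>green_solution_pert\<close> justifies the choice for \<open>1 \<le> n\<close>.\<close>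

definition pert :: "nat \<Rightarrow> nat \<Rightarrow> 'a \<Rightarrow>\<^sub>L 'a" where
  "pert m n = (SOME z. green_solution n z) m"

lemma green_solution_pert:
  assumes "1 \<le> n"
  shows "green_solution n (\<lambda>m. pert m n)"
proof -
  obtain z where "\<And>m. norm (z m) \<le> c m n / (1 - suminf \<kappa>)"
    "\<And>m. z m = (if m = 0 then 0 else G m n) + kernel_sum m z"
    by (rule fixed_point_exists[of "\<lambda>m. if m = 0 then 0 else G m n" "\<lambda>m. c m n" "M n"])
       (use assms norm_G c_nonneg c_le K_c in auto)
  then have "green_solution n z" by (auto simp: green_solution_def)
  then show ?thesis unfolding pert_def by (metis someI)
qed

lemma norm_pert: "1 \<le> n \<Longrightarrow> norm (pert m n) \<le> c m n / (1 - suminf \<kappa>)"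
  using green_solution_pert unfolding green_solution_def by blast

lemma pert_eq: "1 \<le> n \<Longrightarrow> pert m n = (if m = 0 then 0 else G m n) + kernel_sum m (\<lambda>k. pert k n)"
  using green_solution_pert unfolding green_solution_def by blast

lemma norm_pert_le:
  assumes "1 \<le> n"
  shows "norm (pert m n) \<le> M n / (1 - suminf \<kappa>)"
  using norm_pert[OF assms, of m] divide_right_mono[OF c_le[OF assms, of m], of "1 - suminf \<kappa>"] sum_\<kappa>
  by simp

lemma norm_pert_compose_le:
  assumes "1 \<le> n"
  shows "norm (pert m n o\<^sub>L T) \<le> M n / (1 - suminf \<kappa>) * norm T"
  using norm_blinfun_compose[of "pert m n" T] mult_right_mono[OF norm_pert_le[OF assms, of m], of "norm T"]
  by simp

lemma kernel_sum_single:
  "kernel_sum m (\<lambda>k. if k = n then T else 0) = K m n o\<^sub>L T"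
proof -
  have "(\<lambda>k. K m k o\<^sub>L (if k = n then T else 0)) = (\<lambda>k. if k = n then K m k o\<^sub>L T else 0)"
    by auto
  then show ?thesis
    unfolding kernel_sum_def using sums_single[of n "\<lambda>k. K m k o\<^sub>L T"] by (simp add: sums_iff)
qed

text \<open>The kernel inherits the recursion of \<open>G\<close> in \<open>m\<close>, with the
  extra term \<open>B m\<close> exactly at \<open>k = m\<close>. In the summed equation this term
  contributes \<open>B m\<close> composed with \<open>pert m n\<close>, turning \<open>A m\<close>
  into \<open>A m + B m\<close>.\<close>

lemma pert_step:
  assumes mn: "1 \<le> m" "1 \<le> n"
  shows "pert (Suc m) n = ((A m + B m) o\<^sub>L pert m n) + (if Suc m = n then id_blinfun else 0)"
proof -
  interpret comp: bounded_bilinear "(o\<^sub>L) :: ('a \<Rightarrow>\<^sub>L 'a) \<Rightarrow> ('a \<Rightarrow>\<^sub>L 'a) \<Rightarrow> ('a \<Rightarrow>\<^sub>L 'a)"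
    by (rule bounded_bilinear_blinfun_compose)
  let ?z = "\<lambda>k. pert k n"
  have s: "summable (\<lambda>k. K m k o\<^sub>L ?z k)"
    by (rule summable_kernel) (rule norm_pert_le[OF mn(2)])
  have K: "K (Suc m) k = (A m o\<^sub>L K m k) + (if k = m then B m else 0)" for k
    using mn step[of m "Suc k"] by (auto simp: K_def comp.add_left blinfun_compose_assoc blinfun_compose_id_left)
  have "kernel_sum (Suc m) ?z = (\<Sum>k. (A m o\<^sub>L (K m k o\<^sub>L ?z k)) + (if k = m then B k o\<^sub>L ?z k else 0))"
    unfolding kernel_sum_def
    by (intro suminf_cong) (auto simp: K comp.add_left blinfun_compose_assoc)
  also have "\<dots> = (A m o\<^sub>L kernel_sum m ?z) + (B m o\<^sub>L ?z m)"
    using sums_add[OF comp.bounded_linear_right[THEN bounded_linear.sums, OF summable_sums[OF s]]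
        sums_single[of m "\<lambda>k. B k o\<^sub>L ?z k"], of "A m"]
    by (simp add: kernel_sum_def sums_iff)
  finally show ?thesis
    using pert_eq[OF mn(2), of "Suc m"] pert_eq[OF mn(2), of m] step[OF mn] mn
    by (simp add: comp.add_left comp.add_right)
qed

text \<open>By uniqueness: both sides solve the equation with inhomogeneity
  \<open>G m (Suc n)\<close> composed with \<open>A n + B n\<close>. Subtracting the identity at
  \<open>m = n\<close> changes the kernel sum by \<open>- K m n\<close>, which cancels the
  \<open>B n\<close> part; the rest is \<open>shift\<close>.\<close>

lemma pert_shift:
  assumes mn: "1 \<le> m" "1 \<le> n"
  shows "pert m (Suc n) o\<^sub>L (A n + B n) = pert m n - (if m = n then id_blinfun else 0)"
proof -
  interpret comp: bounded_bilinear "(o\<^sub>L) :: ('a \<Rightarrow>\<^sub>L 'a) \<Rightarrow> ('a \<Rightarrow>\<^sub>L 'a) \<Rightarrow> ('a \<Rightarrow>\<^sub>L 'a)"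
    by (rule bounded_bilinear_blinfun_compose)
  let ?T = "A n + B n" and ?C = "M n / (1 - suminf \<kappa>)"
  let ?h = "\<lambda>m. (if m = 0 then 0 else G m (Suc n)) o\<^sub>L ?T"
  let ?y = "\<lambda>m. pert m n - (if m = n then id_blinfun else 0)"
  let ?z = "\<lambda>m. pert m (Suc n) o\<^sub>L ?T"
  have "?y = ?z"
  proof (rule fixed_point_unique)
    show "?z m = ?h m + kernel_sum m ?z" for m
      using pert_eq[of "Suc n" m] norm_pert_le[of "Suc n"]
        kernel_sum_compose[of "\<lambda>k. pert k (Suc n)" "M (Suc n) / (1 - suminf \<kappa>)" m ?T]
      by (simp add: comp.add_left)
    show "norm (?z m) \<le> M (Suc n) / (1 - suminf \<kappa>) * norm ?T" for m
      by (rule norm_pert_compose_le) simp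
    show "norm (?y m) \<le> ?C + norm (id_blinfun :: 'a \<Rightarrow>\<^sub>L 'a)" for m
      using norm_triangle_ineq4[of "pert m n" "if m = n then id_blinfun else 0"] norm_pert_le[OF mn(2), of m]
        norm_ge_zero[of "id_blinfun :: 'a \<Rightarrow>\<^sub>L 'a"] by (auto split: if_splits simp del: norm_ge_zero)
    show "?y m = ?h m + kernel_sum m ?y" for m
    proof -
      have "kernel_sum m ?y = kernel_sum m (\<lambda>k. pert k n) - K m n"
        using kernel_sum_diff[of "\<lambda>k. pert k n" ?C
            "\<lambda>k. if k = n then id_blinfun else 0" "norm (id_blinfun :: 'a \<Rightarrow>\<^sub>L 'a)" m]
          norm_pert_le[OF mn(2)] kernel_sum_single[of m n id_blinfun]
        by (simp add: blinfun_compose_id_right)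
      then show ?thesis
        using pert_eq[OF mn(2), of m] shift[of m n] mn
        by (auto simp: K_def comp.add_right)
    qed
  qed
  then show ?thesis by metis
qed

text \<open>By uniqueness: both sides solve the equation with inhomogeneity \<open>G m n\<close>
  composed with \<open>pert n n\<close>. For the truncated column, \<open>pert n n\<close> is
  expanded by its own equation and \<open>G_comp\<close> collapses the products.\<close>

lemma pert_proj:
  assumes mn: "1 \<le> m" "1 \<le> n"
  shows "pert m n o\<^sub>L pert n n = (if n \<le> m then pert m n else 0)"
proof -
  interpret comp: bounded_bilinear "(o\<^sub>L) :: ('a \<Rightarrow>\<^sub>L 'a) \<Rightarrow> ('a \<Rightarrow>\<^sub>L 'a) \<Rightarrow> ('a \<Rightarrow>\<^sub>L 'a)"
    by (rule bounded_bilinear_blinfun_compose)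
  let ?C = "M n / (1 - suminf \<kappa>)"
  let ?h = "\<lambda>m. (if m = 0 then 0 else G m n) o\<^sub>L pert n n"
  let ?y = "\<lambda>m. if n \<le> m then pert m n else 0"
  let ?z = "\<lambda>m. pert m n o\<^sub>L pert n n"
  have C: "0 \<le> ?C" using norm_pert_le[OF mn(2), of 0] norm_ge_zero order_trans by blast
  then have norm_y: "norm (?y m) \<le> ?C" for m
    using norm_pert_le[OF mn(2), of m] by auto
  have "?y = ?z"
  proof (rule fixed_point_unique)
    show "?z m = ?h m + kernel_sum m ?z" for m
      using pert_eq[OF mn(2), of m] norm_pert_le[OF mn(2)]
        kernel_sum_compose[of "\<lambda>k. pert k n" ?C m "pert n n"]
      by (simp add: comp.add_left)
    show "norm (?z m) \<le> ?C * norm (pert n n)" for m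
      by (rule norm_pert_compose_le[OF mn(2)])
    show "norm (?y m) \<le> ?C" for m by (rule norm_y)
    show "?y m = ?h m + kernel_sum m ?y" for m
    proof (cases "m = 0")
      case True
      then show ?thesis using mn by (simp add: kernel_sum_def K_def)
    next
      case False
      have sn: "summable (\<lambda>k. K n k o\<^sub>L pert k n)"
        by (rule summable_kernel) (rule norm_pert_le[OF mn(2)])
      have sm: "summable (\<lambda>k. K m k o\<^sub>L pert k n)"
        by (rule summable_kernel) (rule norm_pert_le[OF mn(2)])
      have sy: "summable (\<lambda>k. K m k o\<^sub>L ?y k)"
        by (rule summable_kernel) (rule norm_y)
      \<comment> \<open>If \<open>n \<le> m\<close>, the terms with \<open>k < n\<close> come from
        the product and those with \<open>n \<le> k\<close> from the truncated column. If
        \<open>m < n\<close>, the former vanish and the products with \<open>n \<le> k\<close>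
        cancel against the column.\<close>
      have GK: "(G m n o\<^sub>L (K n k o\<^sub>L pert k n)) + (K m k o\<^sub>L ?y k) =
          (if n \<le> m then K m k o\<^sub>L pert k n else 0)" for k
      proof (cases "k = 0")
        case False
        then show ?thesis
          using G_comp[of m n "Suc k"] mn \<open>m \<noteq> 0\<close>
          by (auto simp: K_def comp.minus_left simp flip: blinfun_compose_assoc)
      qed (simp add: K_def)
      have "(G m n o\<^sub>L kernel_sum n (\<lambda>k. pert k n)) + kernel_sum m ?y =
          (\<Sum>k. (G m n o\<^sub>L (K n k o\<^sub>L pert k n)) + (K m k o\<^sub>L ?y k))"
        using sums_add[OF comp.bounded_linear_right[THEN bounded_linear.sums, OF summable_sums[OF sn]]
            summable_sums[OF sy], of "G m n"]
        by (simp add: kernel_sum_def sums_iff)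
      also have "\<dots> = (if n \<le> m then kernel_sum m (\<lambda>k. pert k n) else 0)"
        unfolding GK by (simp add: kernel_sum_def)
      finally show ?thesis
        using pert_eq[OF mn(2), of m] pert_eq[OF mn(2), of n] False mn G_comp[of m n n]
        by (auto simp: comp.add_right add.assoc)
    qed
  qed
  then show ?thesis by metis
qed

lemma green_function_pert: "green_function (\<lambda>n. A n + B n) pert"
  by unfold_locales (fact pert_step pert_shift pert_proj)+

text \<open>The complementary projection is not an entry of \<open>pert\<close>, so the weighted
  estimate is repeated, starting from \<open>norm_Q\<close> instead of
  \<open>norm_G\<close>.\<close>

lemma norm_id_minus_pert:
  assumes n: "1 \<le> n"
  shows "norm (id_blinfun - pert n n) \<le> c n n / (1 - suminf \<kappa>)"
proof -
  let ?S = "kernel_sum n (\<lambda>k. pert k n)"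
  have "norm (K n k) * norm (pert k n) \<le> \<kappa> k * (c n n / (1 - suminf \<kappa>))" for k
  proof -
    have "norm (K n k) * norm (pert k n) \<le> norm (K n k) * (c k n / (1 - suminf \<kappa>))"
      by (intro mult_left_mono norm_pert n) simp
    also have "\<dots> \<le> \<kappa> k * (c n n / (1 - suminf \<kappa>))"
      using divide_right_mono[OF K_c[OF n, of n k], of "1 - suminf \<kappa>"] sum_\<kappa> by simp
    finally show ?thesis .
  qed
  then have "norm ?S \<le> suminf \<kappa> * (c n n / (1 - suminf \<kappa>))" by (rule norm_kernel_sum_le)
  then have "norm ((id_blinfun - G n n) - ?S) \<le> c n n + suminf \<kappa> * (c n n / (1 - suminf \<kappa>))"
    using norm_triangle_ineq4[of "id_blinfun - G n n" ?S] norm_Q[OF n] by linarith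
  moreover have "id_blinfun - pert n n = (id_blinfun - G n n) - ?S"
    using pert_eq[OF n, of n] n by simp
  ultimately have "norm (id_blinfun - pert n n) \<le> c n n + suminf \<kappa> * (c n n / (1 - suminf \<kappa>))"
    by (simp only:)
  also have "\<dots> = c n n / (1 - suminf \<kappa>)" using sum_\<kappa> by (simp add: field_simps)
  finally show ?thesis .
qed

end


section \<open>Submultiplicativity of polynomial weights\<close>

definition poly_weight :: "real \<Rightarrow> real \<Rightarrow> nat \<Rightarrow> nat \<Rightarrow> real" where
  "poly_weight a b m n =
    (if n \<le> m then (real m - real n + 1) powr a else (real n - real m + 1) powr b)"

lemma powr_le_1: "x powr a \<le> 1" if "1 \<le> x" "a \<le> 0" for x a :: real
  using powr_mono2'[of a 1 x] that by simp

lemma poly_weight_nonneg: "0 \<le> poly_weight a b m n"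
  by (simp add: poly_weight_def)

lemma poly_weight_le_1: "a \<le> 0 \<Longrightarrow> b \<le> 0 \<Longrightarrow> poly_weight a b m n \<le> 1"
  by (auto simp: poly_weight_def intro!: powr_le_1)

text \<open>Exponents are nonpositive, so larger bases give smaller weights. If \<open>k\<close> is
  not between \<open>m\<close> and \<open>n\<close>, one factor is already below the target and the
  other is at most 1. A loss occurs only for \<open>n \<le> k < m\<close>.\<close>

lemma poly_weight_mult_le:
  assumes "a \<le> 0" "b \<le> 0"
  shows "poly_weight a b m (Suc k) * poly_weight a b k n \<le> 2 powr (- a) * poly_weight a b m n"
proof -
  note w = poly_weight_def[of a b]
  have triv: "x * y \<le> 2 powr (- a) * z" if "0 \<le> x" "0 \<le> y" "x \<le> 1" "y \<le> 1" "x \<le> z \<or> y \<le> z \<or> x * y \<le> z"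
    for x y z :: real
  proof -
    have "x * y \<le> x" "x * y \<le> y" 
      using that mult_left_mono[of y 1 x] mult_right_mono[of x 1 y] by auto
    then have "x * y \<le> z" using that(5) by linarith
    moreover have "0 \<le> z" using that by (metis mult_nonneg_nonneg order_trans)
    then have "1 * z \<le> 2 powr (- a) * z"
      using assms by (intro mult_right_mono ge_one_powr_ge_zero) auto
    ultimately show ?thesis by linarith
  qed
  note triv' = triv[OF poly_weight_nonneg poly_weight_nonneg
      poly_weight_le_1[OF assms] poly_weight_le_1[OF assms]]
  consider (1) "n \<le> k" "k < m" | (2) "n \<le> m" "m \<le> k" | (3) "k < n" "n \<le> m"
    | (4) "m \<le> k" "k < n" | (5) "k < m" "m < n" | (6) "n \<le> k" "m < n"
    by linarith
  then show ?thesis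
  proof cases
    case 1
    \<comment> \<open>The base of the first factor is \<open>m - (k + 1) + 1 = m - k\<close>, so
      \<open>p + q\<close> is exactly the base of the target. Halving it yields the constant
      \<open>2 powr (- a)\<close>.\<close>
    define p q where "p = real m - real k" and "q = real k - real n + 1"
    have pq: "1 \<le> p" "1 \<le> q" using 1 by (auto simp: p_def q_def)
    then have "0 \<le> (p - 1) * q" "0 \<le> p * (q - 1)" by auto
    then have "(p + q) / 2 \<le> p * q" by (simp add: algebra_simps)
    then have "(p * q) powr a \<le> ((p + q) / 2) powr a"
      using pq assms by (intro powr_mono2') auto
    moreover have "(p * q) powr a = p powr a * q powr a" using pq by (simp add: powr_mult)
    moreover have "((p + q) / 2) powr a = 2 powr (- a) * (p + q) powr a"
      using pq by (simp add: powr_divide powr_minus field_simps)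
    moreover have "poly_weight a b m (Suc k) = p powr a" "poly_weight a b k n = q powr a"
      using 1 by (simp_all add: w p_def q_def)
    moreover have "real m - real n + 1 = p + q" by (simp add: p_def q_def)
    then have "poly_weight a b m n = (p + q) powr a" using 1 by (simp add: w)
    ultimately show ?thesis by simp
  next
    case 2
    then have "poly_weight a b k n \<le> poly_weight a b m n"
      using assms by (auto simp: w intro!: powr_mono2')
    then show ?thesis by (intro triv') auto
  next
    case 3
    then have "poly_weight a b m (Suc k) \<le> poly_weight a b m n"
      using assms by (auto simp: w intro!: powr_mono2')
    then show ?thesis by (intro triv') auto
  next
    case 4
    \<comment> \<open>The shift to \<open>k + 1\<close> makes the first base at least 2, and
      \<open>k < n\<close> does so for the second. The target has base \<open>p + q - 2\<close>, so
      nothing is lost.\<close>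
    define p q where "p = real k - real m + 2" and "q = real n - real k + 1"
    have pq: "2 \<le> p" "2 \<le> q" using 4 by (auto simp: p_def q_def)
    then have "0 \<le> (p - 2) * q" "0 \<le> p * (q - 2)" by auto
    then have "p + q - 2 \<le> p * q" by (simp add: algebra_simps)
    then have "(p * q) powr b \<le> (p + q - 2) powr b"
      using pq assms by (intro powr_mono2') auto
    moreover have "(p * q) powr b = p powr b * q powr b" using pq by (simp add: powr_mult)
    moreover have "p + q - 2 = real n - real m + 1" by (simp add: p_def q_def)
    ultimately have "poly_weight a b m (Suc k) * poly_weight a b k n \<le> poly_weight a b m n"
      using 4 by (simp add: w p_def q_def add.commute)
    then show ?thesis by (intro triv') auto
  next
    case 5
    then have "poly_weight a b k n \<le> poly_weight a b m n"
      using assms by (auto simp: w intro!: powr_mono2')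
    then show ?thesis by (intro triv') auto
  next
    case 6
    then have "poly_weight a b m (Suc k) \<le> poly_weight a b m n"
      using assms by (auto simp: w intro!: powr_mono2')
    then show ?thesis by (intro triv') auto
  qed
qed

section \<open>Perturbation of polynomial dichotomies\<close>

theorem corollary10:
  fixes A B :: "nat \<Rightarrow> 'a::banach \<Rightarrow>\<^sub>L 'a"
    and D \<epsilon> a b \<delta> \<gamma> \<theta> :: real
  assumes "D \<ge> 1" and "\<epsilon> \<ge> 0"
    and "general_dichotomy A
           (\<lambda>m n. D * (real m - real n + 1) powr a * real n powr \<epsilon>)
           (\<lambda>m n. D * (real n - real m + 1) powr b * real n powr \<epsilon>)"
    and "\<delta> > 0"
    and "\<forall>n\<ge>1. norm (B n) \<le> \<delta> * (real n + 1) powr (- \<gamma>)"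
    and "a \<le> b" and "b \<le> 0"
    and "\<epsilon> - \<gamma> < -1"
    and "\<theta> = 2 powr (- a) * D * \<delta> * ((\<Sum>k. real (Suc k) powr (\<epsilon> - \<gamma>)) - 1)"
    and "\<theta> < 1"
  shows "general_dichotomy (\<lambda>n. A n + B n)
           (\<lambda>m n. D / (1 - \<theta>) * (real m - real n + 1) powr a * real n powr \<epsilon>)
           (\<lambda>m n. D / (1 - \<theta>) * (real n - real m + 1) powr b * real n powr \<epsilon>)"
proof -
  define w where "w = poly_weight a b"
  define c where "c m n = D * w m n * real n powr \<epsilon>" for m n
  define S where "S = (\<Sum>k. real (Suc k) powr (\<epsilon> - \<gamma>))"
  define C where "C = 2 powr (- a) * D * \<delta>"
  \<comment> \<open>Subtracting 1 at \<open>k = 0\<close> makes \<open>\<kappa> 0 = 0\<close> and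
    removes the first term of the zeta series, so \<open>suminf \<kappa>\<close> is
    \<open>\<theta>\<close>.\<close>
  define \<kappa> where "\<kappa> k = C * (real (Suc k) powr (\<epsilon> - \<gamma>) - (if k = 0 then 1 else 0))" for k :: nat
  have a: "a \<le> 0" using assms by simp
  have w0: "0 \<le> w m n" and w1: "w m n \<le> 1" for m n
    unfolding w_def using poly_weight_nonneg poly_weight_le_1 a \<open>b \<le> 0\<close> by auto
  have "summable (\<lambda>k. real (Suc k) powr (\<epsilon> - \<gamma>))"
    using assms by (subst summable_Suc_iff) (simp add: summable_real_powr_iff)
  then have "\<kappa> sums (C * (S - 1))"
    unfolding \<kappa>_def S_def
    by (intro sums_mult sums_diff summable_sums) (use sums_single[of 0 "\<lambda>_. 1 :: real"] in simp_all)
  then have \<kappa>: "summable \<kappa>" "suminf \<kappa> = \<theta>"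
    using assms by (auto simp: sums_iff S_def C_def)
  have two: "1 \<le> 2 powr (- a)" using a by (intro ge_one_powr_ge_zero) auto
  \<comment> \<open>The nonuniform factor of the weight at second index \<open>k + 1\<close> is
    absorbed by the decay of \<open>B k\<close>, leaving a term of the zeta series.\<close>
  have B: "norm (B k) * real (Suc k) powr \<epsilon> \<le> \<delta> * real (Suc k) powr (\<epsilon> - \<gamma>)" if "1 \<le> k" for k
  proof -
    have "norm (B k) * real (Suc k) powr \<epsilon> \<le> \<delta> * real (Suc k) powr (- \<gamma>) * real (Suc k) powr \<epsilon>"
      using assms(5) that by (intro mult_right_mono) (auto simp: add.commute)
    also have "\<dots> = \<delta> * real (Suc k) powr (\<epsilon> - \<gamma>)"
      by (simp add: powr_diff powr_minus divide_inverse mult_ac)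
    finally show ?thesis .
  qed
  \<comment> \<open>With \<open>u = v = 1\<close> this gives \<open>c_B\<close>; with
    \<open>v = c k n\<close> and \<open>u = c m n\<close> it gives \<open>c_B_c\<close>.\<close>
  have cB: "c m (Suc k) * norm (B k) * v \<le> \<kappa> k * u"
    if k: "1 \<le> k" and vu: "w m (Suc k) * v \<le> 2 powr (- a) * u" "0 \<le> u" for m k v u
  proof -
    have "c m (Suc k) * norm (B k) * v = D * (norm (B k) * real (Suc k) powr \<epsilon>) * (w m (Suc k) * v)"
      by (simp add: c_def mult_ac)
    also have "\<dots> \<le> D * (norm (B k) * real (Suc k) powr \<epsilon>) * (2 powr (- a) * u)"
      using vu \<open>D \<ge> 1\<close> by (intro mult_left_mono) auto
    also have "\<dots> \<le> D * (\<delta> * real (Suc k) powr (\<epsilon> - \<gamma>)) * (2 powr (- a) * u)"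
      using vu \<open>D \<ge> 1\<close> by (intro mult_right_mono mult_left_mono B k) auto
    also have "\<dots> = \<kappa> k * u" using k by (simp add: \<kappa>_def C_def mult_ac)
    finally show ?thesis .
  qed
  have c: "(if n \<le> m then D * (real m - real n + 1) powr a * real n powr \<epsilon>
      else D * (real n - real m + 1) powr b * real n powr \<epsilon>) = c m n" for m n
    by (simp add: c_def w_def poly_weight_def)
  \<comment> \<open>On the diagonal both powers have base 1, so the bound on the complementary
    projection is also \<open>c n n\<close>.\<close>
  obtain G where G: "green_function A G"
    and norm_G: "\<And>m n. 1 \<le> m \<Longrightarrow> 1 \<le> n \<Longrightarrow> norm (G m n) \<le> c m n"
    and norm_Q: "\<And>n. 1 \<le> n \<Longrightarrow> norm (id_blinfun - G n n) \<le> c n n"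
    using assms(3) unfolding general_dichotomy_iff_green_function c
    by (auto simp: c_def w_def poly_weight_def)
  interpret green_function A G by (rule G)
  interpret perturbed_green_function A G B c "\<lambda>n. D * real n powr \<epsilon>" \<kappa>
  proof
    fix m n k :: nat
    show c0: "0 \<le> c m n" for m n using w0[of m n] \<open>D \<ge> 1\<close> by (simp add: c_def)
    have "w m n * (D * real n powr \<epsilon>) \<le> 1 * (D * real n powr \<epsilon>)"
      using w1[of m n] \<open>D \<ge> 1\<close> by (intro mult_right_mono) auto
    then show "c m n \<le> D * real n powr \<epsilon>" by (simp add: c_def mult_ac)
    show "0 \<le> \<kappa> 0" by (simp add: \<kappa>_def)
    show "suminf \<kappa> < 1" using \<kappa> \<open>\<theta> < 1\<close> by simp
    assume k: "1 \<le> k"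
    show "c m (Suc k) * norm (B k) \<le> \<kappa> k"
      using cB[OF k, of m 1 1] w1[of m "Suc k"] two by simp
    have "w m (Suc k) * w k n * (D * real n powr \<epsilon>) \<le> 2 powr (- a) * w m n * (D * real n powr \<epsilon>)"
      unfolding w_def using a \<open>b \<le> 0\<close> \<open>D \<ge> 1\<close> by (intro mult_right_mono poly_weight_mult_le) auto
    then show "c m (Suc k) * norm (B k) * c k n \<le> \<kappa> k * c m n"
      using c0[of m n] by (intro cB k) (simp_all add: c_def mult_ac)
  qed (fact norm_G norm_Q \<kappa>)+
  have c': "(if n \<le> m then D / (1 - \<theta>) * (real m - real n + 1) powr a * real n powr \<epsilon>
      else D / (1 - \<theta>) * (real n - real m + 1) powr b * real n powr \<epsilon>) = c m n / (1 - \<theta>)" for m n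
    by (simp add: c_def w_def poly_weight_def)
  have "norm (pert m n) \<le> c m n / (1 - \<theta>)" if "1 \<le> n" for m n
    using norm_pert[OF that] \<kappa> by simp
  moreover have "norm (id_blinfun - pert n n) \<le>
      D / (1 - \<theta>) * (real n - real n + 1) powr b * real n powr \<epsilon>" if "1 \<le> n" for n
    using norm_id_minus_pert[OF that] \<kappa> by (simp add: c_def w_def poly_weight_def)
  ultimately show ?thesis
    unfolding general_dichotomy_iff_green_function c'
    using green_function_pert by blast
qed

end
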